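(* Every digraph $D$ admits a fractional majority coloring with total weight at most $3.9602$.
   Context: Digraphs are finite, loopless, have no parallel edges, but may have anti-parallel pairs of edges (digons). For a digraph $D$ and $S\subseteq V(D)$, a vertex $v$ is popular in $S$ if $v\in S$ and more than half of the out-neighbors of $v$ are in $S$. A subset $S\subseteq V(D)$ is stable if no vertex is popular in $S$. Let $S(D)$ be the set of all stable sets of $D$ and $S(D,v)$ the set of all stable sets containing $v$. A fractional majority coloring of $D$ is a function assigning to every $T\in S(D)$ a real weight $w_T\ge 0$ such that $\sum_{T\in S(D,v)}w_T\ge 1$ for every $v\in V(D)$. Its total weight is $\sum_{T\in S(D)}w_T$. *)

theory Defs
  imports Complex_Main "Graph_Theory.Digraph"
begin

definition out_neighbors :: "('a, 'b) pre_digraph \<Rightarrow> 'a \<Rightarrow> 'a set" where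
  "out_neighbors D v = {u. v \<rightarrow>\<^bsub>D\<^esub> u}"

text \<open>A vertex without out-neighbors is never popular, since the inequality is strict.\<close>

definition popular_in :: "('a, 'b) pre_digraph \<Rightarrow> 'a set \<Rightarrow> 'a \<Rightarrow> bool" where
  "popular_in D S v \<longleftrightarrow>
     v \<in> S \<and> real (card (out_neighbors D v \<inter> S)) > real (card (out_neighbors D v)) / 2"

definition stable :: "('a, 'b) pre_digraph \<Rightarrow> 'a set \<Rightarrow> bool" where
  "stable D S \<longleftrightarrow> S \<subseteq> verts D \<and> (\<forall>v \<in> verts D. \<not> popular_in D S v)"

definition stable_sets :: "('a, 'b) pre_digraph \<Rightarrow> 'a set set" where
  "stable_sets D = {S. stable D S}"

definition stable_sets_containing :: "('a, 'b) pre_digraph \<Rightarrow> 'a \<Rightarrow> 'a set set" where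
  "stable_sets_containing D v = {S \<in> stable_sets D. v \<in> S}"

text \<open>
  A weighting is a total function on sets; its values outside \<^term>\<open>stable_sets D\<close> are
  irrelevant to the two definitions below. Both sums range over finite sets if \<^term>\<open>D\<close> is finite.
\<close>

definition fractional_majority_coloring ::
  "('a, 'b) pre_digraph \<Rightarrow> ('a set \<Rightarrow> real) \<Rightarrow> bool" where
  "fractional_majority_coloring D w \<longleftrightarrow>
     (\<forall>T \<in> stable_sets D. w T \<ge> 0) \<and>
     (\<forall>v \<in> verts D. (\<Sum>T \<in> stable_sets_containing D v. w T) \<ge> 1)"

definition total_weight :: "('a, 'b) pre_digraph \<Rightarrow> ('a set \<Rightarrow> real) \<Rightarrow> real" where
  "total_weight D w = (\<Sum>T \<in> stable_sets D. w T)"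

end

theory Submission
  imports Defs "HOL-Probability.Product_PMF"
begin

text \<open>
  Each vertex tries to survive a random experiment whose outcome is always a stable set. If every
  vertex survives with probability at least \<open>c\<close>, then weighting each stable set by its probability
  divided by \<open>c\<close> gives a fractional majority coloring of total weight \<open>1 / c\<close>
  (\<open>fractional_majority_coloring_of_pmf\<close>). It remains to reach \<open>c = 1 / 3.9602\<close>.

  The basic experiment puts every vertex into a random set \<open>S\<close> independently with probability \<open>p\<close>
  and deletes the popular vertices. Deleting vertices makes none of the others popular, so the
  result is stable. A vertex of out-degree \<open>d\<close> survives with probability
  \<open>p * Prob(Bin(d, p) \<le> d / 2)\<close>. For \<open>p = 1 / 2\<close> this can be as low as \<open>1 / 4\<close>, which gives total
  weight 4. For \<open>p\<close> slightly below \<open>1 / 2\<close> the probability exceeds \<open>1 / 4\<close> for all out-degrees other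
  than 1, the worst being \<open>d = 3\<close> (\<open>binomial_lower_half_ge_three\<close>), whereas the probability \<open>p * (1 - p)\<close> for \<open>d = 1\<close> drops
  below \<open>1 / 4\<close>.

  A vertex \<open>v\<close> of out-degree 1 is therefore given a second chance when both it and its only
  out-neighbor \<open>w\<close> lie in \<open>S\<close>: it may stay if \<open>w\<close> is certain to be deleted. If \<open>w\<close> does not have
  out-degree 1, this certainty comes from a global coin \<open>K\<close>, which with small probability \<open>\<theta>\<close> fails
  and then deletes all vertices of out-degree other than 1. If \<open>w\<close> has out-degree 1 as well, then
  \<open>w\<close> loses its first chance when its own out-neighbor is in \<open>S\<close>, and fair coins \<open>R\<close> at the vertices
  ensure that \<open>v\<close> and \<open>w\<close> do not both use their second chance: \<open>v\<close> stays if \<open>R v\<close> and \<open>K\<close> hold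
  and \<open>R w\<close> fails. The experiment is \<open>survivors\<close>, and \<open>prob_survivor_not_one\<close> and
  \<open>prob_survivor_one\<close> bound the survival probabilities; \<open>p = 0.46\<close> and \<open>\<theta> = 0.0195\<close> make both bounds at least \<open>1 / 3.9602\<close>.
\<close>

section \<open>The lower half of a binomial distribution\<close>

lemma pmf_binomial_Suc_Suc:
  fixes p :: real
  assumes "0 \<le> p" "p \<le> 1"
  shows "pmf (binomial_pmf (Suc n) p) (Suc k)
    = p * pmf (binomial_pmf n p) k + (1 - p) * pmf (binomial_pmf n p) (Suc k)"
proof (cases "k < n")
  case True
  then have pow: "(1 - p) ^ (n - k) = (1 - p) * (1 - p) ^ (n - Suc k)"
    by (metis Suc_diff_Suc power_Suc)
  show ?thesis
    using assms by (simp add: pmf_binomial pow) (simp add: ring_distribs)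
next
  case False
  then show ?thesis
    using assms by (cases "k = n") (simp_all add: pmf_binomial binomial_eq_0)
qed

text \<open>
  Adding one trial pushes the number of successes beyond \<open>k\<close> exactly when it was \<open>k\<close> before and the
  new trial succeeds.
\<close>
lemma binomial_cdf_Suc:
  fixes p :: real
  assumes "0 \<le> p" "p \<le> 1"
  shows "measure_pmf.prob (binomial_pmf (Suc n) p) {..k}
    = measure_pmf.prob (binomial_pmf n p) {..k} - p * pmf (binomial_pmf n p) k"
proof (induction k)
  case 0
  show ?case
    using assms by (simp add: measure_measure_pmf_finite pmf_binomial algebra_simps)
next
  case (Suc k)
  then show ?case
    by (simp add: measure_measure_pmf_finite pmf_binomial_Suc_Suc[OF assms] algebra_simps)
qed

text \<open>
  This is Condorcet's jury theorem, for failures. Two further trials change the majority only if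
  the first \<open>2 * k + 1\<close> trials were as balanced as possible: a majority of failures is lost by two
  successes after \<open>k\<close> successes and gained by two failures after \<open>k + 1\<close> successes. The two
  balanced outcomes have the same binomial coefficient, so for \<open>p \<le> 1 / 2\<close> gaining is at least as
  likely as losing.
\<close>
lemma binomial_lower_half_odd_mono:
  fixes p :: real
  assumes "0 \<le> p" "p \<le> 1 / 2"
  shows "measure_pmf.prob (binomial_pmf (2 * k + 1) p) {..k}
    \<le> measure_pmf.prob (binomial_pmf (2 * k + 3) p) {..k + 1}"
proof -
  let ?b = "\<lambda>n k. pmf (binomial_pmf n p) k"
  let ?F = "\<lambda>n k. measure_pmf.prob (binomial_pmf n p) {..k}"
  have p: "0 \<le> p" "p \<le> 1"
    using assms by auto
  have "?F (2 * k + 3) (k + 1) = ?F (2 * k + 2) (k + 1) - p * ?b (2 * k + 2) (k + 1)"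
    using binomial_cdf_Suc[OF p, of "2 * k + 2" "k + 1"] by (simp add: eval_nat_numeral)
  also have "?F (2 * k + 2) (k + 1) = ?F (2 * k + 2) k + ?b (2 * k + 2) (k + 1)"
    by (simp add: measure_measure_pmf_finite)
  also have "?F (2 * k + 2) k = ?F (2 * k + 1) k - p * ?b (2 * k + 1) k"
    using binomial_cdf_Suc[OF p, of "2 * k + 1" k] by simp
  also have "?b (2 * k + 2) (k + 1) = p * ?b (2 * k + 1) k + (1 - p) * ?b (2 * k + 1) (k + 1)"
    using pmf_binomial_Suc_Suc[OF p, of "2 * k + 1" k] by simp
  finally have rec: "?F (2 * k + 3) (k + 1)
      = ?F (2 * k + 1) k + (1 - p)\<^sup>2 * ?b (2 * k + 1) (k + 1) - p\<^sup>2 * ?b (2 * k + 1) k"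
    by (simp add: algebra_simps power2_eq_square)
  have "(2 * k + 1) choose (k + 1) = (2 * k + 1) choose k"
    using binomial_symmetric[of k "2 * k + 1"] by simp
  then have b: "?b (2 * k + 1) (k + 1) = real ((2 * k + 1) choose k) * p ^ (k + 1) * (1 - p) ^ k"
    and b': "?b (2 * k + 1) k = real ((2 * k + 1) choose k) * p ^ k * (1 - p) ^ (k + 1)"
    using p by (simp_all add: pmf_binomial del: binomial_Suc_Suc)
  have "(1 - p)\<^sup>2 * ?b (2 * k + 1) (k + 1) - p\<^sup>2 * ?b (2 * k + 1) k
      = real ((2 * k + 1) choose k) * (p ^ (k + 1) * (1 - p) ^ (k + 1)) * (1 - 2 * p)"
    unfolding b b' by (simp add: power2_eq_square algebra_simps)
  moreover have "\<dots> \<ge> 0"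
    using assms p by simp
  ultimately show ?thesis
    using rec by linarith
qed

text \<open>
  The left-hand side is the probability of at most one success in three trials. Odd \<open>n\<close> are covered
  by monotonicity; for even \<open>n\<close> the threshold \<open>n div 2\<close> is the same for \<open>n + 1\<close> trials, and dropping
  a trial only helps.
\<close>
lemma binomial_lower_half_ge_three:
  fixes p :: real
  assumes "0 \<le> p" "p \<le> 1 / 2" "n \<ge> 2"
  shows "(1 - p)\<^sup>2 * (1 + 2 * p) \<le> measure_pmf.prob (binomial_pmf n p) {k. 2 * k \<le> n}"
proof -
  have p: "0 \<le> p" "p \<le> 1"
    using assms by auto
  have odd: "(1 - p)\<^sup>2 * (1 + 2 * p) \<le> measure_pmf.prob (binomial_pmf (2 * m + 3) p) {..m + 1}" for m
  proof (induction m)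
    case 0
    show ?case
      using p by (simp add: measure_measure_pmf_finite pmf_binomial power2_eq_square
          power3_eq_cube algebra_simps)
  next
    case (Suc m)
    then show ?case
      using binomial_lower_half_odd_mono[OF assms(1,2), of "Suc m"]
      by (simp add: numeral_3_eq_3)
  qed
  show ?thesis
  proof (cases "even n")
    case True
    then obtain j where "n = 2 * j"
      by blast
    with \<open>n \<ge> 2\<close> obtain m where n: "n = 2 * m + 2"
      by (cases j) auto
    then have set: "{k. 2 * k \<le> n} = {..m + 1}"
      by auto
    have "measure_pmf.prob (binomial_pmf (2 * m + 3) p) {..m + 1}
        \<le> measure_pmf.prob (binomial_pmf n p) {..m + 1}"
      using binomial_cdf_Suc[OF p, of n "m + 1"] p n by (simp add: numeral_3_eq_3)
    with odd[of m] show ?thesis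
      unfolding set by linarith
  next
    case False
    then obtain j where "n = 2 * j + 1"
      by (blast elim: oddE)
    with \<open>n \<ge> 2\<close> obtain m where n: "n = 2 * m + 3"
      by (cases j) auto
    then have set: "{k. 2 * k \<le> n} = {..m + 1}"
      by auto
    show ?thesis
      using odd[of m] unfolding set unfolding n .
  qed
qed

section \<open>Independent random choices\<close>

text \<open>
  Unlike in \<open>measure_pmf_prob_product\<close> the sets may be uncountable, as sets of predicates on the
  vertices are; only their countable intersections with the supports matter.
\<close>
lemma prob_pair_pmf_times:
  "measure_pmf.prob (pair_pmf M N) (A \<times> B) = measure_pmf.prob M A * measure_pmf.prob N B"
proof -
  have "measure_pmf.prob (pair_pmf M N) (A \<times> B)
      = measure_pmf.prob (pair_pmf M N) ((A \<inter> set_pmf M) \<times> (B \<inter> set_pmf N))"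
    by (subst measure_Int_set_pmf[symmetric]) (auto intro: arg_cong[where f = "measure_pmf.prob _"])
  also have "\<dots> = measure_pmf.prob M (A \<inter> set_pmf M) * measure_pmf.prob N (B \<inter> set_pmf N)"
    by (rule measure_pmf_prob_product) auto
  finally show ?thesis
    by (simp add: measure_Int_set_pmf)
qed

definition random_subset :: "'a set \<Rightarrow> real \<Rightarrow> ('a \<Rightarrow> bool) pmf" where
  "random_subset V p = Pi_pmf V False (\<lambda>_. bernoulli_pmf p)"

lemma prob_random_subset_pattern:
  assumes "finite V" "0 \<le> p" "p \<le> 1" "A \<subseteq> V" "B \<subseteq> V" "A \<inter> B = {}"
  shows "measure_pmf.prob (random_subset V p) {S. (\<forall>u\<in>A. S u) \<and> (\<forall>u\<in>B. \<not> S u)}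
    = p ^ card A * (1 - p) ^ card B"
proof -
  let ?C = "\<lambda>u. if u \<in> A then {True} else if u \<in> B then {False} else UNIV"
  have fin: "finite A" "finite B"
    using assms by (auto intro: finite_subset)
  have eq: "{S. (\<forall>u\<in>A. S u) \<and> (\<forall>u\<in>B. \<not> S u)} = Pi V ?C"
    using assms by (fastforce simp: Pi_iff split: if_splits)
  have "measure_pmf.prob (random_subset V p) (Pi V ?C)
      = (\<Prod>u\<in>V. measure_pmf.prob (bernoulli_pmf p) (?C u))"
    unfolding random_subset_def by (rule measure_Pi_pmf_Pi[OF assms(1)])
  also have "\<dots> = (\<Prod>u\<in>A \<union> B. measure_pmf.prob (bernoulli_pmf p) (?C u))"
    using assms by (intro prod.mono_neutral_right) auto
  also have "\<dots> = (\<Prod>u\<in>A. measure_pmf.prob (bernoulli_pmf p) (?C u))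
      * (\<Prod>u\<in>B. measure_pmf.prob (bernoulli_pmf p) (?C u))"
    using fin assms by (intro prod.union_disjoint) auto
  also have "(\<Prod>u\<in>A. measure_pmf.prob (bernoulli_pmf p) (?C u)) = p ^ card A"
    using assms by (simp add: measure_pmf_single)
  also have "(\<Prod>u\<in>B. measure_pmf.prob (bernoulli_pmf p) (?C u)) = (\<Prod>u\<in>B. 1 - p)"
    using assms by (intro prod.cong) (auto simp: measure_pmf_single)
  finally show ?thesis
    unfolding eq by simp
qed

text \<open>
  With \<open>N\<close> the set of out-neighbors of \<open>v\<close>, this is the probability that \<open>v\<close> is chosen without
  becoming popular.
\<close>
lemma prob_random_subset_lower_half:
  assumes "finite V" "0 \<le> p" "p \<le> 1" "v \<in> V" "N \<subseteq> V" "v \<notin> N"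
  shows "measure_pmf.prob (random_subset V p) {S. S v \<and> 2 * card {u \<in> N. S u} \<le> card N}
    = p * measure_pmf.prob (binomial_pmf (card N) p) {k. 2 * k \<le> card N}"
proof -
  let ?q = "\<lambda>_ :: 'a. bernoulli_pmf p" and ?W = "V - {v}"
  let ?light = "{S. 2 * card {u \<in> N. S u} \<le> card N}"
  have N: "finite N" "N \<subseteq> ?W" "finite ?W"
    using assms finite_subset by auto
  have "random_subset V p = map_pmf (\<lambda>(y, f). f(v := y)) (pair_pmf (bernoulli_pmf p) (Pi_pmf ?W False ?q))"
    using Pi_pmf_insert[of ?W v False ?q] N assms(4) by (simp add: random_subset_def insert_absorb)
  moreover have "(\<lambda>(y, f). f(v := y)) -` {S. S v \<and> 2 * card {u \<in> N. S u} \<le> card N} = {True} \<times> ?light"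
  proof -
    have "{u \<in> N. (f(v := y)) u} = {u \<in> N. f u}" for f y
      using \<open>v \<notin> N\<close> by auto
    then show ?thesis
      by auto
  qed
  ultimately have "measure_pmf.prob (random_subset V p) {S. S v \<and> 2 * card {u \<in> N. S u} \<le> card N}
      = p * measure_pmf.prob (Pi_pmf ?W False ?q) ?light"
    using assms by (simp add: prob_pair_pmf_times measure_pmf_single)
  moreover have "measure_pmf.prob (Pi_pmf ?W False ?q) ?light
      = measure_pmf.prob (binomial_pmf (card N) p) {k. 2 * k \<le> card N}"
  proof -
    have "binomial_pmf (card N) p = map_pmf (\<lambda>f. card {u \<in> N. f u}) (Pi_pmf N False ?q)"
      using N assms by (intro binomial_pmf_altdef') auto
    also have "\<dots> = map_pmf (\<lambda>f. card {u \<in> N. f u}) (Pi_pmf ?W False ?q)"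
      unfolding Pi_pmf_subset[OF N(3,2)] by (simp add: map_pmf_comp cong: conj_cong)
    finally show ?thesis
      by (simp add: vimage_def)
  qed
  ultimately show ?thesis
    by simp
qed

section \<open>The random stable set\<close>

definition out_degree_of :: "('a, 'b) pre_digraph \<Rightarrow> 'a \<Rightarrow> nat" where
  "out_degree_of D v = card (out_neighbors D v)"

text \<open>
  A vertex of out-degree 1 has its first chance in the disjunct \<open>\<not> S w\<close> and its second chance in the
  rest. The condition \<open>S x\<close> on the out-neighbor \<open>x\<close> of \<open>w\<close> says that \<open>w\<close> has lost its first chance.
  In that case \<open>w\<close> could still be saved by a failure of \<open>K\<close>, if \<open>x\<close> does not have out-degree 1, or by
  \<open>R w\<close>, if it does; \<open>K\<close> and \<open>\<not> R w\<close> exclude both.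
\<close>
definition survivors ::
  "('a, 'b) pre_digraph \<Rightarrow> ('a \<Rightarrow> bool) \<times> ('a \<Rightarrow> bool) \<times> bool \<Rightarrow> 'a set" where
  "survivors D = (\<lambda>(S, R, K). {v \<in> verts D. S v \<and>
     (if out_degree_of D v = 1
      then \<forall>w \<in> out_neighbors D v. \<not> S w \<or>
        (if out_degree_of D w = 1 then K \<and> R v \<and> \<not> R w \<and> (\<forall>x \<in> out_neighbors D w. S x) else \<not> K)
      else K \<and> 2 * card {u \<in> out_neighbors D v. S u} \<le> out_degree_of D v)})"

definition survivor_pmf ::
  "('a, 'b) pre_digraph \<Rightarrow> real \<Rightarrow> real \<Rightarrow> (('a \<Rightarrow> bool) \<times> ('a \<Rightarrow> bool) \<times> bool) pmf" where
  "survivor_pmf D p \<theta> =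
     pair_pmf (random_subset (verts D) p) (pair_pmf (random_subset (verts D) (1 / 2)) (bernoulli_pmf (1 - \<theta>)))"

lemma out_neighbors_digraph:
  assumes "digraph D"
  shows "out_neighbors D v \<subseteq> verts D" "finite (out_neighbors D v)" "v \<notin> out_neighbors D v"
proof -
  interpret digraph D by fact
  show "out_neighbors D v \<subseteq> verts D"
    by (auto simp: out_neighbors_def adj_in_verts)
  then show "finite (out_neighbors D v)"
    by (rule finite_subset) simp
  show "v \<notin> out_neighbors D v"
    by (auto simp: out_neighbors_def dest: adj_not_same)
qed

text \<open>
  A surviving vertex of out-degree 1 has an out-neighbor that does not survive: whichever clause
  saved the vertex excludes the out-neighbor. Any other survivor is unpopular already in \<open>S\<close>, which
  contains all survivors.
\<close>
lemma stable_survivors: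
  assumes "digraph D"
  shows "stable D (survivors D (S, R, K))"
  unfolding stable_def
proof (intro conjI ballI)
  let ?X = "survivors D (S, R, K)"
  show "?X \<subseteq> verts D"
    by (auto simp: survivors_def)
  fix v
  show "\<not> popular_in D ?X v"
  proof (cases "v \<in> ?X")
    case False
    then show ?thesis
      by (simp add: popular_in_def)
  next
    case vX: True
    let ?N = "out_neighbors D v"
    have fin: "finite ?N"
      by (rule out_neighbors_digraph[OF assms])
    have "2 * card (?N \<inter> ?X) \<le> card ?N"
    proof (cases "out_degree_of D v = 1")
      case True
      then obtain w where w: "?N = {w}"
        unfolding out_degree_of_def by (auto simp: card_1_singleton_iff)
      with vX True have "\<not> S w \<or>
        (if out_degree_of D w = 1 then K \<and> R v \<and> \<not> R w \<and> (\<forall>x \<in> out_neighbors D w. S x) else \<not> K)"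
        by (auto simp: survivors_def)
      \<comment> \<open>If \<open>w\<close> has out-degree 1, its first chance needs some out-neighbor outside \<open>S\<close>, and its
        second chance needs \<open>R w\<close> or the failure of \<open>K\<close>.\<close>
      moreover have "out_neighbors D w \<noteq> {}" if "out_degree_of D w = 1"
        using that by (auto simp: out_degree_of_def)
      ultimately have "w \<notin> ?X"
        by (auto simp: survivors_def)
      then show ?thesis
        using w by simp
    next
      case False
      have "card (?N \<inter> ?X) \<le> card {u \<in> ?N. S u}"
        using fin by (intro card_mono) (auto simp: survivors_def)
      with False vX show ?thesis
        by (auto simp: survivors_def out_degree_of_def)
    qed
    then show ?thesis
      by (simp add: popular_in_def)
  qed
qed

section \<open>Survival probabilities\<close>

text \<open>
  The vertex must be chosen, the global coin must not fail, and at most half of the out-neighbors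
  may be chosen; these three events are independent. Out-degree 3 is the worst case.
\<close>
lemma prob_survivor_not_one:
  assumes "digraph D" "v \<in> verts D" "out_degree_of D v \<noteq> 1"
    and p: "0 \<le> p" "p \<le> 1 / 2" and \<theta>: "0 \<le> \<theta>" "\<theta> \<le> 1"
  shows "(1 - \<theta>) * (p * ((1 - p)\<^sup>2 * (1 + 2 * p)))
    \<le> measure_pmf.prob (survivor_pmf D p \<theta>) {\<omega>. v \<in> survivors D \<omega>}"
proof -
  interpret digraph D by fact
  let ?N = "out_neighbors D v"
  let ?E = "{S. S v \<and> 2 * card {u \<in> ?N. S u} \<le> card ?N}"
  have event: "{\<omega>. v \<in> survivors D \<omega>} = ?E \<times> UNIV \<times> {True}"
    using assms(2,3) by (auto simp: survivors_def out_degree_of_def)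
  have "measure_pmf.prob (survivor_pmf D p \<theta>) {\<omega>. v \<in> survivors D \<omega>}
      = measure_pmf.prob (random_subset (verts D) p) ?E * (1 - \<theta>)"
    unfolding event survivor_pmf_def using \<theta> by (simp add: prob_pair_pmf_times measure_pmf_single)
  also have "measure_pmf.prob (random_subset (verts D) p) ?E
      = p * measure_pmf.prob (binomial_pmf (card ?N) p) {k. 2 * k \<le> card ?N}"
    using p assms(2) out_neighbors_digraph[OF assms(1)] by (intro prob_random_subset_lower_half) auto
  finally have prob: "measure_pmf.prob (survivor_pmf D p \<theta>) {\<omega>. v \<in> survivors D \<omega>}
      = (1 - \<theta>) * (p * measure_pmf.prob (binomial_pmf (card ?N) p) {k. 2 * k \<le> card ?N})"
    by (simp add: mult.commute)
  have "(1 - p)\<^sup>2 * (1 + 2 * p) \<le> measure_pmf.prob (binomial_pmf (card ?N) p) {k. 2 * k \<le> card ?N}"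
  proof (cases "card ?N = 0")
    case True
    have "1 - (1 - p)\<^sup>2 * (1 + 2 * p) = p\<^sup>2 * (3 - 2 * p)"
      by (simp add: power2_eq_square algebra_simps)
    also have "\<dots> \<ge> 0"
      using p by simp
    finally show ?thesis
      using True p by (simp add: binomial_pmf_0)
  next
    case False
    then show ?thesis
      using p assms(3) by (intro binomial_lower_half_ge_three) (auto simp: out_degree_of_def)
  qed
  then show ?thesis
    unfolding prob using p \<theta> by (intro mult_left_mono) auto
qed

text \<open>
  The first summand is the first chance. The minimum is over the two kinds of second chance: either
  \<open>v\<close> and \<open>w\<close> are chosen and the global coin fails, or the walk \<open>v, w, x\<close> along
  out-neighbors is chosen, the coins of \<open>v\<close> and \<open>w\<close> fall the right way and the global coin
  does not fail.
\<close>
lemma prob_survivor_one: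
  assumes "digraph D" "v \<in> verts D" "out_degree_of D v = 1"
    and p: "0 \<le> p" "p \<le> 1" and \<theta>: "0 \<le> \<theta>" "\<theta> \<le> 1"
  shows "p * (1 - p) + min (p\<^sup>2 * \<theta>) (p ^ 3 * (1 / 4 * (1 - \<theta>)))
    \<le> measure_pmf.prob (survivor_pmf D p \<theta>) {\<omega>. v \<in> survivors D \<omega>}"
proof -
  interpret digraph D by fact
  note nbr = out_neighbors_digraph[OF assms(1)]
  let ?V = "verts D"
  let ?M = "survivor_pmf D p \<theta>"
  obtain w where w: "out_neighbors D v = {w}"
    using assms(3) unfolding out_degree_of_def by (auto simp: card_1_singleton_iff)
  have wV: "w \<in> ?V" and vw: "v \<noteq> w"
    using nbr(1,3)[of v] w by auto
  let ?A = "{S. S v \<and> \<not> S w} \<times> (UNIV :: (('a \<Rightarrow> bool) \<times> bool) set)"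
  have "{S. S v \<and> \<not> S w} = {S. (\<forall>u\<in>{v}. S u) \<and> (\<forall>u\<in>{w}. \<not> S u)}"
    by auto
  then have A: "measure_pmf.prob ?M ?A = p * (1 - p)"
    using prob_random_subset_pattern[of ?V p "{v}" "{w}"] p assms(2) wV vw
    by (simp add: survivor_pmf_def prob_pair_pmf_times)
  have split: "measure_pmf.prob ?M ?A + measure_pmf.prob ?M B
      \<le> measure_pmf.prob ?M {\<omega>. v \<in> survivors D \<omega>}"
    if "?A \<inter> B = {}" "?A \<union> B \<subseteq> {\<omega>. v \<in> survivors D \<omega>}" for B
  proof -
    have "measure_pmf.prob ?M ?A + measure_pmf.prob ?M B = measure_pmf.prob ?M (?A \<union> B)"
      using that(1) by (intro measure_pmf.finite_measure_Union[symmetric]) auto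
    also have "\<dots> \<le> measure_pmf.prob ?M {\<omega>. v \<in> survivors D \<omega>}"
      using that(2) by (intro measure_pmf.finite_measure_mono) auto
    finally show ?thesis .
  qed
  show ?thesis
  proof (cases "out_degree_of D w = 1")
    case False
    let ?S = "{S. S v \<and> S w}"
    let ?B = "?S \<times> (UNIV :: ('a \<Rightarrow> bool) set) \<times> {False}"
    have "?S = {S. (\<forall>u\<in>{v, w}. S u) \<and> (\<forall>u\<in>{}. \<not> S u)}"
      by auto
    then have "measure_pmf.prob (random_subset ?V p) ?S = p\<^sup>2"
      using prob_random_subset_pattern[of ?V p "{v, w}" "{}"] p assms(2) wV vw
      by (simp add: card_insert_if power2_eq_square)
    then have "measure_pmf.prob ?M ?B = p\<^sup>2 * \<theta>"
      using \<theta> by (simp add: survivor_pmf_def prob_pair_pmf_times measure_pmf_single)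
    moreover have "?A \<inter> ?B = {}" "?A \<union> ?B \<subseteq> {\<omega>. v \<in> survivors D \<omega>}"
      using assms(2,3) w False by (auto simp: survivors_def)
    ultimately show ?thesis
      using split[of ?B] A by linarith
  next
    case True
    then obtain x where x: "out_neighbors D w = {x}"
      unfolding out_degree_of_def by (auto simp: card_1_singleton_iff)
    have xV: "x \<in> ?V"
      using nbr(1)[of w] x by auto
    let ?S = "{S. S v \<and> S w \<and> S x}" and ?R = "{R. R v \<and> \<not> R w}"
    let ?B = "?S \<times> ?R \<times> {True}"
    \<comment> \<open>Possibly \<open>x = v\<close>, namely on a digon; this makes the event only more likely.\<close>
    have "card {v, w, x} \<le> 3"
      by (simp add: card_insert_if)
    then have "p ^ 3 \<le> p ^ card {v, w, x}"
      using p by (intro power_decreasing) auto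
    also have "\<dots> = measure_pmf.prob (random_subset ?V p) {S. (\<forall>u\<in>{v, w, x}. S u) \<and> (\<forall>u\<in>{}. \<not> S u)}"
      using prob_random_subset_pattern[of ?V p "{v, w, x}" "{}"] p assms(2) wV xV by simp
    also have "\<dots> = measure_pmf.prob (random_subset ?V p) ?S"
      by (rule arg_cong[where f = "measure_pmf.prob _"]) auto
    finally have S: "p ^ 3 \<le> measure_pmf.prob (random_subset ?V p) ?S" .
    have "?R = {R. (\<forall>u\<in>{v}. R u) \<and> (\<forall>u\<in>{w}. \<not> R u)}"
      by auto
    then have R: "measure_pmf.prob (random_subset ?V (1 / 2)) ?R = 1 / 4"
      using prob_random_subset_pattern[of ?V "1 / 2" "{v}" "{w}"] assms(2) wV vw by simp
    have "measure_pmf.prob ?M ?B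
        = measure_pmf.prob (random_subset ?V p) ?S * (1 / 4 * (1 - \<theta>))"
      unfolding survivor_pmf_def prob_pair_pmf_times R using \<theta> by (simp add: measure_pmf_single)
    then have "p ^ 3 * (1 / 4 * (1 - \<theta>)) \<le> measure_pmf.prob ?M ?B"
      using mult_right_mono[OF S, of "1 / 4 * (1 - \<theta>)"] \<theta> by simp
    moreover have "?A \<inter> ?B = {}" "?A \<union> ?B \<subseteq> {\<omega>. v \<in> survivors D \<omega>}"
      using assms(2,3) w x True by (auto simp: survivors_def)
    ultimately show ?thesis
      using split[of ?B] A by linarith
  qed
qed

section \<open>From random stable sets to fractional colorings\<close>

lemma fractional_majority_coloring_of_pmf:
  fixes D :: "('a, 'b) pre_digraph" and \<mu> :: "'a set pmf"
  assumes "finite (verts D)" "c > 0"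
    and stable: "set_pmf \<mu> \<subseteq> stable_sets D"
    and cover: "\<And>v. v \<in> verts D \<Longrightarrow> c \<le> measure_pmf.prob \<mu> {T. v \<in> T}"
  shows "\<exists>w. fractional_majority_coloring D w \<and> total_weight D w = 1 / c"
proof (intro exI conjI)
  let ?w = "\<lambda>T. pmf \<mu> T / c"
  have fin: "finite (stable_sets D)"
    by (rule finite_subset[of _ "Pow (verts D)"]) (use assms(1) in \<open>auto simp: stable_sets_def stable_def\<close>)
  show "total_weight D ?w = 1 / c"
    using sum_pmf_eq_1[OF fin stable] by (simp add: total_weight_def flip: sum_divide_distrib)
  show "fractional_majority_coloring D ?w"
    unfolding fractional_majority_coloring_def
  proof (intro conjI ballI)
    show "0 \<le> ?w T" for T
      using \<open>c > 0\<close> by simp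
    fix v
    assume "v \<in> verts D"
    have "measure_pmf.prob \<mu> {T. v \<in> T} = measure_pmf.prob \<mu> (stable_sets_containing D v)"
      by (rule measure_prob_cong_0)
        (use stable in \<open>auto simp: stable_sets_containing_def set_pmf_iff\<close>)
    also have "\<dots> = (\<Sum>T\<in>stable_sets_containing D v. pmf \<mu> T)"
      by (rule measure_measure_pmf_finite) (use fin in \<open>simp add: stable_sets_containing_def\<close>)
    finally have "c \<le> (\<Sum>T\<in>stable_sets_containing D v. pmf \<mu> T)"
      using cover[OF \<open>v \<in> verts D\<close>] by simp
    then show "1 \<le> (\<Sum>T\<in>stable_sets_containing D v. ?w T)"
      using \<open>c > 0\<close> by (simp add: field_simps flip: sum_divide_distrib)
  qed
qed

theorem theorem6:
  fixes D :: "('a, 'b) pre_digraph"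
  assumes "digraph D"
  shows "\<exists>w. fractional_majority_coloring D w \<and> total_weight D w \<le> 3.9602"
proof -
  interpret digraph D by fact
  \<comment> \<open>The constants almost balance the two bounds on the survival probability, which are about
    \<open>0.252519\<close> for out-degree other than 1 and \<open>0.252526\<close> for out-degree 1, against
    \<open>1 / 3.9602 < 0.252513\<close>.\<close>
  define p \<theta> :: real where "p = 23 / 50" and "\<theta> = 39 / 2000"
  define \<mu> where "\<mu> = map_pmf (survivors D) (survivor_pmf D p \<theta>)"
  have "set_pmf \<mu> \<subseteq> stable_sets D"
    using stable_survivors[OF assms] by (auto simp: \<mu>_def stable_sets_def)
  moreover have "1 / 3.9602 \<le> measure_pmf.prob \<mu> {T. v \<in> T}" if "v \<in> verts D" for v
  proof -
    have "measure_pmf.prob \<mu> {T. v \<in> T} = measure_pmf.prob (survivor_pmf D p \<theta>) {\<omega>. v \<in> survivors D \<omega>}"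
      by (simp add: \<mu>_def vimage_def)
    moreover have "1 / 3.9602 \<le> (1 - \<theta>) * (p * ((1 - p)\<^sup>2 * (1 + 2 * p)))"
      by (simp add: p_def \<theta>_def power2_eq_square)
    moreover have "1 / 3.9602 \<le> p * (1 - p) + min (p\<^sup>2 * \<theta>) (p ^ 3 * (1 / 4 * (1 - \<theta>)))"
      by (simp add: p_def \<theta>_def power2_eq_square power3_eq_cube)
    ultimately show ?thesis
      using prob_survivor_not_one[OF assms that, of p \<theta>] prob_survivor_one[OF assms that, of p \<theta>]
      by (cases "out_degree_of D v = 1") (auto simp: p_def \<theta>_def)
  qed
  ultimately show ?thesis
    using fractional_majority_coloring_of_pmf[of D "1 / 3.9602" \<mu>] by auto
qed

end
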